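(* Let $(\mu_N)_{N\in\mathbb{N}}$ be a sequence of probability measures on $V$ solving the stationarity equations $$\mu_N(x)\sum_{y:(x,y)\in E}r_N(x,y)=\sum_{y:(y,x)\in E}\mu_N(y)r_N(y,x),\qquad\forall x\in V,$$ and assume that the limits $$W(x):=-\lim_{N\to+\infty}N^{-1}\log\mu_N(x),\qquad\forall x\in V,$$ exist. Then $W$ satisfies $$W(x)+\min_{y:(x,y)\in E}\{\Delta(x,y)\}=\min_{y:(y,x)\in E}\{W(y)+\Delta(y,x)\},\qquad\forall x\in V.$$
   Context: $\mathcal{G}=(V,E)$ is a finite, strongly connected directed graph without loops. For each $N\in\mathbb{N}$, $(r_N(x,y))_{(x,y)\in E}$ are the (positive) jump rates of an irreducible continuous-time Markov chain on $V$. Standing assumption: for every $(x,y)\in E$ the limit $\Delta(x,y):=-\lim_{N\to+\infty}N^{-1}\log r_N(x,y)$ exists, is finite and is $\ge0$. *)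

theory Defs
  imports "HOL-Probability.Probability" "Graph_Theory.Graph_Theory"
begin

end

theory Submission
  imports Defs
begin

text \<open>
  On the scale of exponential decay rates, products of positive sequences become sums and finite
  sums become minima. Applying this to both sides of the stationarity equation gives the claim.
  Strong connectivity is used to see that the stationary measures charge every vertex, so that
  the logarithms are genuine.
\<close>

text \<open>Rates are taken in \<open>ereal\<close> because a stationary weight may decay faster
  than exponentially, so that \<open>W\<close> can be infinite. At \<open>N = 0\<close> the quotient
  is 0, which does not affect the limit.\<close>

definition has_decay_rate :: "(nat \<Rightarrow> real) \<Rightarrow> ereal \<Rightarrow> bool" where
  "has_decay_rate a L \<longleftrightarrow> (\<lambda>N. ereal (- (ln (a N) / real N))) \<longlonglongrightarrow> L"

lemma has_decay_rate_unique:
  "has_decay_rate a L \<Longrightarrow> has_decay_rate a M \<Longrightarrow> L = M"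
  unfolding has_decay_rate_def by (rule LIMSEQ_unique)

text \<open>The logarithm turns the product into a sum. Finiteness of \<open>M\<close> excludes the
  form \<infinity> - \<infinity>; below, \<open>M\<close> is a rate coming from \<Delta>, while
  \<open>L\<close> may be infinite.\<close>

lemma has_decay_rate_mult:
  assumes "\<And>N. a N > 0" "\<And>N. b N > 0"
    and "has_decay_rate a L" "has_decay_rate b M" "\<bar>M\<bar> \<noteq> \<infinity>"
  shows "has_decay_rate (\<lambda>N. a N * b N) (L + M)"
proof -
  have "(\<lambda>N. ereal (- (ln (a N) / real N)) + ereal (- (ln (b N) / real N))) \<longlonglongrightarrow> L + M"
    using assms(3-5) unfolding has_decay_rate_def by (intro tendsto_add_ereal_general1)
  moreover have "ereal (- (ln (a N) / real N)) + ereal (- (ln (b N) / real N))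
      = ereal (- (ln (a N * b N) / real N))" for N
    using assms(1)[of N] assms(2)[of N] by (simp add: ln_mult_pos add_divide_distrib)
  ultimately show ?thesis
    unfolding has_decay_rate_def by simp
qed

text \<open>The sum lies between max(a, b) and 2 max(a, b), and the factor 2 costs only ln 2 / N,
  which vanishes in the limit. The sign change turns the maximum into a minimum of rates.\<close>

lemma has_decay_rate_add:
  assumes a: "\<And>N. a N > 0" and b: "\<And>N. b N > 0"
    and L: "has_decay_rate a L" and M: "has_decay_rate b M"
  shows "has_decay_rate (\<lambda>N. a N + b N) (min L M)"
proof -
  define m where "m N = min (ereal (- (ln (a N) / real N))) (ereal (- (ln (b N) / real N)))" for N
  have m: "m \<longlonglongrightarrow> min L M"
    using L M unfolding has_decay_rate_def m_def by (intro tendsto_min)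
  have "(\<lambda>N. ereal (- (ln 2 / real N))) \<longlonglongrightarrow> ereal 0"
    by (intro tendsto_intros) (use tendsto_minus[OF lim_const_over_n[of "ln 2"]] in simp)
  \<comment> \<open>Addition passes to the limit even if \<open>min L M\<close> is infinite, because
    the other limit is 0.\<close>
  with m have "(\<lambda>N. m N + ereal (- (ln 2 / real N))) \<longlonglongrightarrow> min L M + ereal 0"
    by (intro tendsto_add_ereal_general1) auto
  then have lower: "(\<lambda>N. m N + ereal (- (ln 2 / real N))) \<longlonglongrightarrow> min L M"
    by simp
  \<comment> \<open>Dividing by \<open>real N\<close> preserves order; for \<open>N = 0\<close> all
    quotients are 0, so the identity still holds.\<close>
  have m_eq: "m N = ereal (- (ln (max (a N) (b N)) / real N))" for N
  proof -
    have "ln (max (a N) (b N)) = max (ln (a N)) (ln (b N))"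
      using a[of N] b[of N] by (auto simp: max_def)
    then show ?thesis
      by (auto simp: m_def min_def max_def divide_le_cancel)
  qed
  have "m N + ereal (- (ln 2 / real N)) \<le> ereal (- (ln (a N + b N) / real N))" for N
  proof -
    have "ln (a N + b N) \<le> ln (2 * max (a N) (b N))"
      using a[of N] b[of N] by (subst ln_le_cancel_iff) auto
    also have "\<dots> = ln 2 + ln (max (a N) (b N))"
      using a[of N] by (intro ln_mult_pos) auto
    finally have "ln (a N + b N) / real N \<le> (ln 2 + ln (max (a N) (b N))) / real N"
      by (rule divide_right_mono) simp
    then show ?thesis
      by (simp add: m_eq add_divide_distrib)
  qed
  moreover have "ereal (- (ln (a N + b N) / real N)) \<le> m N" for N
  proof -
    have "ln (max (a N) (b N)) \<le> ln (a N + b N)"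
      using a[of N] b[of N] by (subst ln_le_cancel_iff) auto
    then show ?thesis
      by (simp add: m_eq divide_right_mono)
  qed
  ultimately show ?thesis
    unfolding has_decay_rate_def
    by (intro tendsto_sandwich[OF _ _ lower m]) auto
qed

lemma has_decay_rate_sum:
  assumes "finite I" "I \<noteq> {}"
    and "\<And>i N. i \<in> I \<Longrightarrow> f i N > 0" "\<And>i. i \<in> I \<Longrightarrow> has_decay_rate (f i) (L i)"
  shows "has_decay_rate (\<lambda>N. \<Sum>i\<in>I. f i N) (MIN i\<in>I. L i)"
  using assms
proof (induction rule: finite_ne_induct)
  case (singleton i)
  then show ?case by simp
next
  case (insert i I)
  have "has_decay_rate (\<lambda>N. f i N + (\<Sum>i\<in>I. f i N)) (min (L i) (MIN i\<in>I. L i))"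
    using insert by (intro has_decay_rate_add sum_pos) auto
  then show ?case
    using insert by simp
qed

text \<open>Positivity spreads along arcs: if \<open>u\<close> has mass, the inflow into its
  successor \<open>v\<close> is positive, and by stationarity \<open>v\<close> cannot have mass 0.
  Some vertex has mass, and every vertex is reachable from it.\<close>

lemma stationary_pmf_pos:
  fixes G :: "'a pair_pre_digraph" and r :: "'a \<Rightarrow> 'a \<Rightarrow> real"
  assumes "pair_fin_digraph G" and conn: "strongly_connected (with_proj G)"
    and r: "\<And>x y. (x, y) \<in> parcs G \<Longrightarrow> r x y > 0"
    and supp: "set_pmf p \<subseteq> pverts G"
    and stat: "\<And>x. x \<in> pverts G \<Longrightarrow>
           pmf p x * (\<Sum>y | (x, y) \<in> parcs G. r x y)
             = (\<Sum>y | (y, x) \<in> parcs G. pmf p y * r y x)"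
    and x: "x \<in> pverts G"
  shows "pmf p x > 0"
proof -
  interpret pair_fin_digraph G by fact
  obtain z where z: "z \<in> set_pmf p"
    using set_pmf_not_empty[of p] by blast
  have "reachable (with_proj G) z x"
    using conn x z supp by (auto simp: strongly_connected_def)
  then show ?thesis
  proof (induction rule: reachable_induct)
    case base
    show ?case using z by (simp add: pmf_positive)
  next
    case (step u v)
    then have uv: "(u, v) \<in> parcs G" by simp
    have "finite {y. (y, v) \<in> parcs G}"
      by (rule finite_subset[OF _ pair_finite_verts]) (auto dest: in_arcsD1)
    then have "0 < (\<Sum>y | (y, v) \<in> parcs G. pmf p y * r y v)"
      using uv step.IH r by (intro sum_pos2[of _ u]) (auto simp: less_imp_le)
    then have "pmf p v \<noteq> 0"
      using stat[of v] in_arcsD2[OF uv] by auto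
    then show ?case by (simp add: pmf_pos)
  qed
qed

theorem lemma2p2:
  fixes G :: "'a pair_pre_digraph"
    and r :: "nat \<Rightarrow> 'a \<Rightarrow> 'a \<Rightarrow> real"
    and \<Delta> :: "'a \<Rightarrow> 'a \<Rightarrow> real"
    and \<mu> :: "nat \<Rightarrow> 'a pmf"
    and W :: "'a \<Rightarrow> ereal"
  assumes "pair_digraph G"
    and "strongly_connected (with_proj G)"
    and "\<And>N x y. (x, y) \<in> parcs G \<Longrightarrow> r N x y > 0"
    and "\<And>x y. (x, y) \<in> parcs G \<Longrightarrow> (\<lambda>N. - (ln (r N x y) / real N)) \<longlonglongrightarrow> \<Delta> x y"
    and "\<And>x y. (x, y) \<in> parcs G \<Longrightarrow> \<Delta> x y \<ge> 0"
    and "\<And>N. set_pmf (\<mu> N) \<subseteq> pverts G"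
    and "\<And>N x. x \<in> pverts G \<Longrightarrow>
           pmf (\<mu> N) x * (\<Sum>y | (x, y) \<in> parcs G. r N x y)
             = (\<Sum>y | (y, x) \<in> parcs G. pmf (\<mu> N) y * r N y x)"
    and "\<And>x. x \<in> pverts G \<Longrightarrow> (\<lambda>N. ereal (- (ln (pmf (\<mu> N) x) / real N))) \<longlonglongrightarrow> W x"
  shows "\<forall>x \<in> pverts G.
           W x + (MIN y\<in>{y. (x, y) \<in> parcs G}. ereal (\<Delta> x y))
             = (MIN y\<in>{y. (y, x) \<in> parcs G}. W y + ereal (\<Delta> y x))"
proof
  fix x assume x: "x \<in> pverts G"
  interpret pair_digraph G by fact
  let ?out = "{y. (x, y) \<in> parcs G}" and ?in = "{y. (y, x) \<in> parcs G}"
  have fin: "finite ?out" "finite ?in"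
    by (auto intro!: finite_subset[OF _ pair_finite_verts] dest: in_arcsD1 in_arcsD2)
  have pos: "pmf (\<mu> N) y > 0" if "y \<in> pverts G" for N y
    by (rule stationary_pmf_pos[OF pair_fin_digraph assms(2) assms(3) assms(6) assms(7) that])
  \<comment> \<open>All masses and rates are positive, so either side of the stationarity equation
    at \<open>x\<close> vanishes exactly when its index set is empty. Any fixed \<open>N\<close>
    would do; 0 is chosen.\<close>
  have out_iff_in: "?out = {} \<longleftrightarrow> ?in = {}"
  proof -
    have "(\<Sum>y\<in>?out. r 0 x y) > 0" if "?out \<noteq> {}"
      using fin that assms(3) by (intro sum_pos) auto
    moreover have "(\<Sum>y\<in>?in. pmf (\<mu> 0) y * r 0 y x) > 0" if "?in \<noteq> {}"
      using fin that assms(3) pos by (intro sum_pos mult_pos_pos) (auto dest: in_arcsD1)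
    ultimately show ?thesis
      using assms(7)[OF x, of 0] pos[OF x, of 0] by fastforce
  qed
  show "W x + (MIN y\<in>?out. ereal (\<Delta> x y)) = (MIN y\<in>?in. W y + ereal (\<Delta> y x))"
  proof (cases "?out = {}")
    case True
    \<comment> \<open>The graph is a single vertex: both minima are the same unspecified value \<open>Min {}\<close>,
      and the equation holds because \<open>W x = 0\<close>.\<close>
    have "pverts G \<subseteq> {x}"
    proof
      fix v assume "v \<in> pverts G"
      then have "reachable (with_proj G) x v"
        using assms(2) x by (auto simp: strongly_connected_def)
      then show "v \<in> {x}"
        \<comment> \<open>A nontrivial path would start with an arc leaving \<open>x\<close>, and
          there is none.\<close>
        by (cases rule: converse_reachable_cases) (use True in auto)
    qed
    then have "pmf (\<mu> N) x = 1" for N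
      using assms(6)[of N] set_pmf_subset_singleton[of "\<mu> N" x] by auto
    then have "(\<lambda>N. ereal 0) \<longlonglongrightarrow> W x"
      using assms(8)[OF x] by simp
    then have "W x = 0"
      by (simp add: LIMSEQ_const_iff zero_ereal_def)
    moreover have "?in = {}"
      using True out_iff_in by simp
    ultimately show ?thesis
      using True by simp
  next
    case False
    have r_rate: "has_decay_rate (\<lambda>N. r N u v) (ereal (\<Delta> u v))" if "(u, v) \<in> parcs G" for u v
      using assms(4)[OF that] by (simp add: has_decay_rate_def)
    have \<mu>_rate: "has_decay_rate (\<lambda>N. pmf (\<mu> N) u) (W u)" if "u \<in> pverts G" for u
      using assms(8)[OF that] by (simp add: has_decay_rate_def)
    \<comment> \<open>The minimum over a nonempty finite set is attained, so it is one of the real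
      numbers \<open>\<Delta> x y\<close>; this gives the finiteness required by
      \<open>has_decay_rate_mult\<close>.\<close>
    have "(MIN y\<in>?out. ereal (\<Delta> x y)) \<in> (\<lambda>y. ereal (\<Delta> x y)) ` ?out"
      using fin False by (intro Min_in) auto
    then have "\<bar>MIN y\<in>?out. ereal (\<Delta> x y)\<bar> \<noteq> \<infinity>"
      by auto
    then have "has_decay_rate (\<lambda>N. pmf (\<mu> N) x * (\<Sum>y\<in>?out. r N x y))
        (W x + (MIN y\<in>?out. ereal (\<Delta> x y)))"
      using fin False assms(3) pos x r_rate \<mu>_rate
      by (intro has_decay_rate_mult has_decay_rate_sum sum_pos) auto
    moreover have "has_decay_rate (\<lambda>N. \<Sum>y\<in>?in. pmf (\<mu> N) y * r N y x)
        (MIN y\<in>?in. W y + ereal (\<Delta> y x))"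
      using fin False out_iff_in assms(3) pos r_rate \<mu>_rate
      by (intro has_decay_rate_sum has_decay_rate_mult mult_pos_pos) (auto dest: in_arcsD1)
    \<comment> \<open>By stationarity the two sequences coincide for every \<open>N\<close>, so
      their rates agree.\<close>
    ultimately show ?thesis
      using assms(7)[OF x] by (auto intro: has_decay_rate_unique)
  qed
qed

end
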